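(* Let $M\in\mathbb{R}^{p\times q}$ be nonzero, let $\rho\geq\|M\|_2^2$, let $d\ge0$ be an integer, and let $p_d(t)=\sum_{\ell=0}^dc_\ell t^\ell$ be a polynomial with real coefficients. (i) Suppose that $M$ has full column rank. Let $$B=\frac{M^TM}{\rho},\qquad X_0^{(d)}=\frac1\rho\,p_d(B)M^T,\qquad \eta_d=\max_{\lambda\in\sigma(B)}|1-\lambda p_d(\lambda)| .$$ (ii) Suppose that $M$ has full row rank. Let $$C=\frac{MM^T}{\rho},\qquad X_0^{(d)}=M^T\frac1\rho\,p_d(C),\qquad \eta_d=\max_{\lambda\in\sigma(C)}|1-\lambda p_d(\lambda)| .$$ In either case, starting from $X_0=X_0^{(d)}$, consider the iteration $X_{k+1}=2X_k-X_kMX_k$. If $\eta_d<1$, then $X_k\to M^\dagger$. In the full-column-rank case (i), for every $k\ge0$, $$I_q-X_kM=\left(I_q-X_0^{(d)}M\right)^{2^k},\qquad\|I_q-X_kM\|_2=\eta_d^{2^k}.$$ In the full-row-rank case (ii), for every $k\ge0$, $$I_p-MX_k=\left(I_p-MX_0^{(d)}\right)^{2^k},\qquad\|I_p-MX_k\|_2=\eta_d^{2^k}.$$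
   Context: $\sigma(B)$ denotes the spectrum (set of eigenvalues) of the square matrix $B$, $\|\cdot\|_2$ the spectral norm, and $M^\dagger$ the usual Moore--Penrose inverse of a real matrix. *)

theory Defs
  imports "HOL-Analysis.Analysis"
begin

text \<open>Matrix powers need their own recursion: on \<open>'a ^ 'n ^ 'n\<close> the type-class product
  \<open>*\<close> is entrywise, while the matrix product is \<open>**\<close>.\<close>

primrec matpow :: "'a::semiring_1 ^ 'n ^ 'n \<Rightarrow> nat \<Rightarrow> 'a ^ 'n ^ 'n" where
  "matpow A 0 = mat 1"
| "matpow A (Suc k) = A ** matpow A k"

definition matpoly :: "nat \<Rightarrow> (nat \<Rightarrow> real) \<Rightarrow> real ^ 'n ^ 'n \<Rightarrow> real ^ 'n ^ 'n" where
  "matpoly d c A = (\<Sum>l\<le>d. c l *\<^sub>R matpow A l)"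

definition spectral_norm :: "real ^ 'n ^ 'm \<Rightarrow> real" where
  "spectral_norm A = onorm (\<lambda>x. A *v x)"

text \<open>The eigenvalues of a real square matrix are its complex eigenvalues; no symmetry is
  built into the definition.\<close>

definition spectrum :: "real ^ 'n ^ 'n \<Rightarrow> complex set" where
  "spectrum A =
     {z. \<exists>v :: complex ^ 'n. v \<noteq> 0 \<and> (\<chi> i j. complex_of_real (A $ i $ j)) *v v = z *s v}"

definition max_residual :: "nat \<Rightarrow> (nat \<Rightarrow> real) \<Rightarrow> real ^ 'n ^ 'n \<Rightarrow> real" where
  "max_residual d c A =
     Max ((\<lambda>z. cmod (1 - z * (\<Sum>l\<le>d. complex_of_real (c l) * z ^ l))) ` spectrum A)"

definition is_moore_penrose :: "real ^ 'n ^ 'm \<Rightarrow> real ^ 'm ^ 'n \<Rightarrow> bool" where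
  "is_moore_penrose A X \<longleftrightarrow>
     A ** X ** A = A \<and> X ** A ** X = X \<and>
     transpose (A ** X) = A ** X \<and> transpose (X ** A) = X ** A"

lemma is_moore_penrose_unique:
  assumes "is_moore_penrose A X" "is_moore_penrose A Y"
  shows "X = Y"
proof -
  note defs = assms[unfolded is_moore_penrose_def]
  have "A ** X = transpose (A ** X)" using defs by simp
  also have "\<dots> = transpose ((A ** Y) ** (A ** X))" using defs by (simp add: matrix_mul_assoc)
  also have "\<dots> = (A ** X) ** (A ** Y)" using defs by (simp only: matrix_transpose_mul)
  also have "\<dots> = A ** Y" using defs by (simp add: matrix_mul_assoc)
  finally have AX: "A ** X = A ** Y" .
  have "X ** A = transpose (X ** A)" using defs by simp
  also have "\<dots> = transpose ((X ** A) ** (Y ** A))" using defs by (metis matrix_mul_assoc)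
  also have "\<dots> = (Y ** A) ** (X ** A)" using defs by (simp only: matrix_transpose_mul)
  also have "\<dots> = Y ** A" using defs by (metis matrix_mul_assoc)
  finally have XA: "X ** A = Y ** A" .
  show ?thesis using defs AX XA by (metis matrix_mul_assoc)
qed

definition moore_penrose :: "real ^ 'n ^ 'm \<Rightarrow> real ^ 'm ^ 'n" where
  "moore_penrose A = (THE X. is_moore_penrose A X)"

primrec newton_schulz :: "real ^ 'n ^ 'm \<Rightarrow> real ^ 'm ^ 'n \<Rightarrow> nat \<Rightarrow> real ^ 'm ^ 'n" where
  "newton_schulz M X0 0 = X0"
| "newton_schulz M X0 (Suc k) =
     2 *\<^sub>R newton_schulz M X0 k - newton_schulz M X0 k ** M ** newton_schulz M X0 k"

end

theory Submission
  imports Defs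
begin

text \<open>A Newton--Schulz step squares the residual \<open>I - X\<^sub>k M\<close>, so the residual is the
  \<open>2\<^sup>k\<close>-th power of the symmetric matrix \<open>E = I - p(B) B\<close>, whose norm is the largest
  \<open>|1 - \<mu> p(\<mu>)|\<close> over the eigenvalues \<open>\<mu>\<close> of \<open>B\<close>. The rows of every \<open>X\<^sub>k\<close> stay in the row
  space of \<open>M\<^sup>\<dagger>\<close>, so \<open>M\<^sup>\<dagger> - X\<^sub>k = (I - X\<^sub>k M) M\<^sup>\<dagger>\<close>, which tends to zero. The full-row-rank case
  follows by transposition.\<close>

section \<open>Eigenvectors of self-adjoint maps from the Rayleigh quotient\<close>

text \<open>By compactness the quadratic form attains a maximum on the unit sphere of
  \<open>S\<close>, and a maximizer is an eigenvector because a perturbation along its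
  eigen-residual would otherwise increase the quotient. Allowing an invariant subspace
  \<open>S\<close> lets the lemma serve both for the whole space and for an eigenspace.\<close>

lemma self_adjoint_has_maximal_eigenvector:
  fixes f :: "'a::euclidean_space \<Rightarrow> 'a"
  assumes lin: "linear f" and adj: "\<And>x y. x \<bullet> f y = f x \<bullet> y"
    and S: "subspace S" and inv: "\<And>x. x \<in> S \<Longrightarrow> f x \<in> S" and nontriv: "S \<noteq> {0}"
  obtains v \<mu> where "v \<in> S" "norm v = 1" "f v = \<mu> *\<^sub>R v"
    "\<And>x. x \<in> S \<Longrightarrow> x \<bullet> f x \<le> \<mu> * (norm x)\<^sup>2"
proof -
  let ?K = "sphere 0 1 \<inter> S"
  obtain u where u: "u \<in> S" "u \<noteq> 0"
    using nontriv subspace_0[OF S] by blast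
  have "u /\<^sub>R norm u \<in> ?K"
    using u S by (simp add: subspace_scale)
  then have "?K \<noteq> {}" by blast
  moreover have "compact ?K"
    by (intro compact_Int_closed compact_sphere closed_subspace S)
  moreover have "continuous_on ?K (\<lambda>x. x \<bullet> f x)"
    by (intro continuous_intros linear_continuous_on) (simp add: lin linear_conv_bounded_linear[symmetric])
  ultimately obtain v where v: "v \<in> ?K" and max: "\<And>y. y \<in> ?K \<Longrightarrow> y \<bullet> f y \<le> v \<bullet> f v"
    using continuous_attains_sup[of ?K "\<lambda>x. x \<bullet> f x"] by blast
  define m where "m = v \<bullet> f v"
  have bound: "x \<bullet> f x \<le> m * (norm x)\<^sup>2" if "x \<in> S" for x
  proof (cases "x = 0")
    case False
    have "x /\<^sub>R norm x \<in> ?K" using that False S by (simp add: subspace_scale)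
    from max[OF this] have "(x \<bullet> f x) / (norm x)\<^sup>2 \<le> m"
      by (simp add: m_def linear_scale[OF lin] power2_eq_square field_simps)
    then show ?thesis using False by (simp add: divide_le_eq)
  qed (use linear_0[OF lin] in simp)
  \<comment> \<open>\<open>w\<close> measures how far \<open>v\<close> is from being an eigenvector;
    \<open>g\<close> collects the second-order terms when the bound is applied to
    \<open>v + t w\<close>.\<close>
  define w where "w = f v - m *\<^sub>R v"
  define g where "g = m * (norm w)\<^sup>2 - w \<bullet> f w"
  have vS: "v \<in> S" and nv: "norm v = 1" using v by auto
  have vv: "v \<bullet> v = 1" using nv by (simp add: dot_square_norm)
  have wS: "w \<in> S" unfolding w_def by (intro subspace_diff subspace_scale S inv vS)
  have vfw: "v \<bullet> f w = f v \<bullet> w" by (rule adj)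
  \<comment> \<open>The zeroth-order terms cancel since \<open>v\<close> attains the maximum
    \<open>m\<close>, leaving a linear term in \<open>t\<close> against a quadratic one. Such an
    inequality for all \<open>t\<close> forces \<open>w = 0\<close>.\<close>
  have quad: "2 * t * (w \<bullet> w) \<le> t\<^sup>2 * g" for t
  proof -
    have "v + t *\<^sub>R w \<in> S" by (intro subspace_add subspace_scale S vS wS)
    from bound[OF this]
    have "m + t * (v \<bullet> f w) + t * (w \<bullet> f v) + t\<^sup>2 * (w \<bullet> f w)
        \<le> m * (1 + 2 * t * (v \<bullet> w) + t\<^sup>2 * (w \<bullet> w))"
      by (simp add: linear_add[OF lin] linear_scale[OF lin] inner_add_left inner_add_right
          power2_norm_eq_inner vv m_def[symmetric] inner_commute[of w v] algebra_simps)
        (simp add: power2_eq_square algebra_simps)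
    moreover have "f v \<bullet> w = w \<bullet> w + m * (v \<bullet> w)"
      using inner_add_left[of w "m *\<^sub>R v" w] by (simp add: w_def)
    ultimately show ?thesis
      by (simp add: g_def vfw inner_commute[of w "f v"] inner_commute[of "f v" v] power2_norm_eq_inner algebra_simps)
  qed
  have "w \<bullet> w \<le> 0"
  proof (cases "g > 0")
    case True
    \<comment> \<open>This \<open>t\<close> is small enough for the linear term to dominate: the two
      sides differ by a factor of two.\<close>
    have "2 * (w \<bullet> w)\<^sup>2 / g \<le> (w \<bullet> w)\<^sup>2 / g"
      using quad[of "(w \<bullet> w) / g"] True by (simp add: power2_eq_square field_simps)
    then have "(w \<bullet> w)\<^sup>2 \<le> 0" using True by (simp add: divide_le_cancel)
    then show ?thesis by simp
  next
    case False
    then show ?thesis using quad[of 1] by simp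
  qed
  then have "w = 0" by (metis antisym inner_eq_zero_iff inner_ge_zero)
  then have "f v = m *\<^sub>R v" by (simp add: w_def)
  with vS nv bound that show ?thesis by blast
qed

section \<open>Algebra of matrix powers and matrix polynomials\<close>

lemma inner_symmetric_matrix:
  fixes A :: "real ^ 'n ^ 'n"
  assumes "transpose A = A"
  shows "x \<bullet> (A *v y) = (A *v x) \<bullet> y"
  by (metis assms dot_lmul_matrix vector_transpose_matrix)

lemma matrix_add_rdistrib: "(A + B) ** C = A ** C + B ** C"
  by (simp add: matrix_matrix_mult_def vec_eq_iff sum.distrib distrib_right)

lemma matrix_diff_rdistrib:
  fixes A B :: "'a::ring_1 ^ 'n ^ 'm"
  shows "(A - B) ** C = A ** C - B ** C"
  by (simp add: matrix_matrix_mult_def vec_eq_iff sum_subtractf left_diff_distrib)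

lemma matrix_diff_ldistrib:
  fixes A B :: "'a::ring_1 ^ 'n ^ 'm"
  shows "C ** (A - B) = C ** A - C ** B"
  by (simp add: matrix_matrix_mult_def vec_eq_iff sum_subtractf right_diff_distrib)

lemma matpow_add: "matpow A (m + n) = matpow A m ** matpow A n"
  by (induction m) (simp_all add: matrix_mul_assoc)

lemma matpow_commute:
  assumes "B ** A = A ** B"
  shows "B ** matpow A k = matpow A k ** B"
  by (induction k) (simp, metis assms matpow.simps(2) matrix_mul_assoc)

lemma transpose_matpow:
  fixes A :: "'a::comm_semiring_1 ^ 'n ^ 'n"
  shows "transpose (matpow A k) = matpow (transpose A) k"
  by (induction k) (simp_all add: matrix_transpose_mul matpow_commute)

lemma matpow_eigenvector:
  fixes A :: "real ^ 'n ^ 'n"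
  assumes "A *v x = \<mu> *\<^sub>R x"
  shows "matpow A k *v x = \<mu> ^ k *\<^sub>R x"
  by (induction k) (simp_all add: assms matrix_vector_mul_assoc[symmetric] matrix_vector_mult_scaleR)

lemma matpoly_Suc: "matpoly (Suc d) c A = matpoly d c A + c (Suc d) *\<^sub>R matpow A (Suc d)"
  by (simp add: matpoly_def)

lemma matpoly_0: "matpoly 0 c A = c 0 *\<^sub>R mat 1"
  by (simp add: matpoly_def)

lemma matpoly_commute:
  fixes A :: "real ^ 'n ^ 'n"
  shows "A ** matpoly d c A = matpoly d c A ** A"
proof (induction d)
  case (Suc d)
  have "A ** matpow A (Suc d) = matpow A (Suc d) ** A"
    by (simp add: matpow_commute del: matpow.simps)
  then show ?case
    using Suc by (simp add: matpoly_Suc matrix_add_ldistrib matrix_add_rdistrib matrix_scalar_ac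
        scalar_matrix_assoc[symmetric] del: matpow.simps)
qed (simp add: matpoly_0 matrix_scalar_ac scalar_matrix_assoc[symmetric])

lemma transpose_add: "transpose (A + B) = transpose A + transpose B"
  by (simp add: transpose_def vec_eq_iff)

lemma transpose_diff: "transpose (A - B) = transpose A - transpose B"
  by (simp add: transpose_def vec_eq_iff)

lemma transpose_matpoly: "transpose (matpoly d c A) = matpoly d c (transpose A)"
  by (induction d)
    (simp_all add: matpoly_0 matpoly_Suc transpose_add transpose_scalar transpose_matpow
      del: matpow.simps)

lemma matpoly_eigenvector:
  fixes A :: "real ^ 'n ^ 'n"
  assumes "A *v x = \<mu> *\<^sub>R x"
  shows "matpoly d c A *v x = (\<Sum>l\<le>d. c l * \<mu> ^ l) *\<^sub>R x"
  by (induction d)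
    (simp_all add: matpoly_0 matpoly_Suc matrix_vector_mult_add_rdistrib matpow_eigenvector[OF assms]
      scaleR_matrix_vector_assoc[symmetric] scaleR_add_left del: matpow.simps)

section \<open>The spectrum of a real symmetric matrix\<close>

text \<open>Split a complex eigenvector into real and imaginary parts \<open>a\<close> and
  \<open>b\<close>. Symmetry applied to the pair \<open>a\<close>, \<open>b\<close> forces
  \<open>Im z = 0\<close>, and then whichever of \<open>a\<close>, \<open>b\<close> is nonzero is a
  real eigenvector.\<close>

lemma spectrum_symmetric:
  fixes A :: "real ^ 'n ^ 'n"
  assumes sym: "transpose A = A"
  shows "spectrum A = complex_of_real ` {\<mu>. \<exists>v. v \<noteq> 0 \<and> A *v v = \<mu> *\<^sub>R v}"
proof (intro set_eqI iffI)
  fix z assume "z \<in> spectrum A"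
  then obtain v where v: "v \<noteq> 0" "(\<chi> i j. complex_of_real (A $ i $ j)) *v v = z *s v"
    by (auto simp: spectrum_def)
  define a b where "a = (\<chi> i. Re (v $ i))" and "b = (\<chi> i. Im (v $ i))"
  have comp: "(\<Sum>j\<in>UNIV. complex_of_real (A $ i $ j) * v $ j) = z * v $ i" for i
    using v(2) by (simp add: vec_eq_iff matrix_vector_mult_def)
  have Aa: "A *v a = Re z *\<^sub>R a - Im z *\<^sub>R b"
    using arg_cong[OF comp, of Re] by (simp add: vec_eq_iff matrix_vector_mult_def a_def b_def)
  have Ab: "A *v b = Im z *\<^sub>R a + Re z *\<^sub>R b"
    using arg_cong[OF comp, of Im]
    by (simp add: vec_eq_iff matrix_vector_mult_def a_def b_def add.commute)
  have nz: "a \<noteq> 0 \<or> b \<noteq> 0"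
    using v(1) by (auto simp: vec_eq_iff a_def b_def complex_eq_iff)
  have "b \<bullet> (A *v a) = (A *v b) \<bullet> a" by (rule inner_symmetric_matrix[OF sym])
  then have "Im z * (a \<bullet> a + b \<bullet> b) = 0"
    by (simp add: Aa Ab inner_diff_right inner_add_left inner_commute[of b a] algebra_simps)
  moreover have "a \<bullet> a + b \<bullet> b > 0"
    using nz by (metis add_nonneg_pos add_pos_nonneg inner_ge_zero inner_gt_zero_iff)
  ultimately have im: "Im z = 0" by simp
  then have "z = complex_of_real (Re z)" by (simp add: complex_eq_iff)
  moreover have "\<exists>v. v \<noteq> 0 \<and> A *v v = Re z *\<^sub>R v"
    using nz Aa Ab im by auto
  ultimately show "z \<in> complex_of_real ` {\<mu>. \<exists>v. v \<noteq> 0 \<and> A *v v = \<mu> *\<^sub>R v}" by blast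
next
  fix z assume "z \<in> complex_of_real ` {\<mu>. \<exists>v. v \<noteq> 0 \<and> A *v v = \<mu> *\<^sub>R v}"
  then obtain \<mu> v where z: "z = complex_of_real \<mu>" and v: "v \<noteq> 0" "A *v v = \<mu> *\<^sub>R v" by blast
  let ?w = "(\<chi> i. complex_of_real (v $ i)) :: complex ^ 'n"
  have "(\<Sum>j\<in>UNIV. complex_of_real (A $ i $ j) * complex_of_real (v $ j))
      = complex_of_real \<mu> * complex_of_real (v $ i)" for i
  proof -
    have "(\<Sum>j\<in>UNIV. A $ i $ j * v $ j) = \<mu> * v $ i"
      using v(2) by (simp add: vec_eq_iff matrix_vector_mult_def)
    then show ?thesis by (metis (no_types, lifting) of_real_mult of_real_sum sum.cong)
  qed
  then have "(\<chi> i j. complex_of_real (A $ i $ j)) *v ?w = z *s ?w"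
    by (simp add: vec_eq_iff matrix_vector_mult_def z)
  moreover have "?w \<noteq> 0" using v(1) by (simp add: vec_eq_iff)
  ultimately show "z \<in> spectrum A" unfolding spectrum_def by blast
qed

text \<open>Eigenvectors for distinct eigenvalues are orthogonal, and a pairwise orthogonal set is
  finite in finite dimension. Finiteness is what makes \<open>Max\<close> in
  \<open>max_residual\<close> a genuine maximum.\<close>

lemma finite_eigenvalues_symmetric:
  fixes A :: "real ^ 'n ^ 'n"
  assumes sym: "transpose A = A"
  shows "finite {\<mu>. \<exists>v. v \<noteq> 0 \<and> A *v v = \<mu> *\<^sub>R v}" (is "finite ?E")
proof -
  obtain v where v: "\<And>\<mu>. \<mu> \<in> ?E \<Longrightarrow> v \<mu> \<noteq> 0 \<and> A *v v \<mu> = \<mu> *\<^sub>R v \<mu>"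
    by (atomize_elim, intro choice) blast
  have orth: "v \<mu> \<bullet> v \<nu> = 0" if "\<mu> \<in> ?E" "\<nu> \<in> ?E" "\<mu> \<noteq> \<nu>" for \<mu> \<nu>
    using inner_symmetric_matrix[OF sym, of "v \<mu>" "v \<nu>"] v[OF that(1)] v[OF that(2)] that(3)
    by simp
  \<comment> \<open>A vector chosen for two distinct eigenvalues would be orthogonal to itself,
    hence zero.\<close>
  have "inj_on v ?E"
  proof (rule inj_onI, rule ccontr)
    fix \<mu> \<nu> assume "\<mu> \<in> ?E" "\<nu> \<in> ?E" "v \<mu> = v \<nu>" "\<mu> \<noteq> \<nu>"
    then show False using orth[of \<mu> \<nu>] v[of \<nu>] by simp
  qed
  moreover have "finite (v ` ?E)"
  proof (rule pairwise_orthogonal_imp_finite)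
    show "pairwise orthogonal (v ` ?E)"
      using orth unfolding pairwise_def orthogonal_def by blast
  qed
  ultimately show ?thesis by (rule finite_imageD[rotated])
qed

section \<open>The spectral norm, and eigenvectors at which it is attained\<close>

lemma norm_le_spectral_norm: "norm (A *v x) \<le> spectral_norm A * norm x"
  unfolding spectral_norm_def by (rule onorm) simp

lemma spectral_norm_nonneg: "0 \<le> spectral_norm A"
  unfolding spectral_norm_def by (rule onorm_pos_le) simp

lemma spectral_norm_least:
  assumes "\<And>x. norm (A *v x) \<le> b * norm x"
  shows "spectral_norm A \<le> b"
  unfolding spectral_norm_def by (rule onorm_le) (rule assms)

lemma eigenvalue_le_spectral_norm:
  assumes "A *v v = \<mu> *\<^sub>R v" "v \<noteq> 0"
  shows "\<bar>\<mu>\<bar> \<le> spectral_norm A"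
  using norm_le_spectral_norm[of A v] assms by simp

text \<open>One inequality is submultiplicativity; the other comes from
  \<open>(norm (A *v x))^2 = x \<bullet> ((A ** A) *v x)\<close> and Cauchy-Schwarz.\<close>

lemma spectral_norm_symmetric_square:
  fixes A :: "real ^ 'n ^ 'n"
  assumes sym: "transpose A = A"
  shows "spectral_norm (A ** A) = (spectral_norm A)\<^sup>2"
proof (rule antisym)
  show "spectral_norm (A ** A) \<le> (spectral_norm A)\<^sup>2"
  proof (rule spectral_norm_least)
    fix x
    have "norm (A *v (A *v x)) \<le> spectral_norm A * (spectral_norm A * norm x)"
      by (meson norm_le_spectral_norm mult_left_mono order_trans spectral_norm_nonneg)
    then show "norm ((A ** A) *v x) \<le> (spectral_norm A)\<^sup>2 * norm x"
      by (simp add: matrix_vector_mul_assoc power2_eq_square mult.assoc)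
  qed
  have "spectral_norm A \<le> sqrt (spectral_norm (A ** A))"
  proof (rule spectral_norm_least)
    fix x
    have "(norm (A *v x))\<^sup>2 = x \<bullet> ((A ** A) *v x)"
      by (simp add: power2_norm_eq_inner inner_symmetric_matrix[OF sym] matrix_vector_mul_assoc[symmetric])
    also have "\<dots> \<le> norm x * (spectral_norm (A ** A) * norm x)"
      by (meson norm_cauchy_schwarz norm_le_spectral_norm mult_left_mono order_trans norm_ge_zero)
    finally have "sqrt ((norm (A *v x))\<^sup>2) \<le> sqrt (spectral_norm (A ** A) * (norm x)\<^sup>2)"
      by (intro real_sqrt_le_mono) (simp add: power2_eq_square mult_ac)
    then show "norm (A *v x) \<le> sqrt (spectral_norm (A ** A)) * norm x"
      by (simp add: real_sqrt_mult)
  qed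
  then show "(spectral_norm A)\<^sup>2 \<le> spectral_norm (A ** A)"
    by (metis power_mono real_sqrt_pow2 spectral_norm_nonneg)
qed

text \<open>Powers of a symmetric matrix stay symmetric, so the squaring identity can be iterated;
  exponents \<open>2 ^ k\<close> are exactly those the iteration produces.\<close>

lemma spectral_norm_symmetric_matpow:
  fixes A :: "real ^ 'n ^ 'n"
  assumes sym: "transpose A = A"
  shows "spectral_norm (matpow A (2 ^ k)) = spectral_norm A ^ (2 ^ k)"
proof (induction k)
  case (Suc k)
  have "matpow A (2 ^ Suc k) = matpow A (2 ^ k) ** matpow A (2 ^ k)"
    by (simp add: mult_2 matpow_add)
  moreover have "transpose (matpow A (2 ^ k)) = matpow A (2 ^ k)"
    by (simp add: transpose_matpow sym)
  ultimately show ?case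
    by (simp add: spectral_norm_symmetric_square Suc power_even_eq)
qed simp

text \<open>The top eigenspace of \<open>E\<^sup>2\<close> is invariant under \<open>A\<close>, hence contains an eigenvector of \<open>A\<close>.
  No simultaneous diagonalization is needed.\<close>

lemma eigenvector_attaining_spectral_norm:
  fixes A E :: "real ^ 'n ^ 'n"
  assumes symA: "transpose A = A" and symE: "transpose E = E" and comm: "A ** E = E ** A"
  obtains v \<mu> where "v \<noteq> 0" "A *v v = \<mu> *\<^sub>R v" "E *v (E *v v) = (spectral_norm E)\<^sup>2 *\<^sub>R v"
proof -
  have selfE: "x \<bullet> (E *v (E *v y)) = (E *v (E *v x)) \<bullet> y" for x y
    by (simp add: inner_symmetric_matrix[OF symE])
  have lin: "linear (\<lambda>x. E *v (E *v x))"
    by (simp add: matrix_vector_mul_assoc)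
  \<comment> \<open>First use of the variational lemma: \<open>s\<close> is the top eigenvalue of
    \<open>E ** E\<close> on the whole space.\<close>
  obtain u s where u: "norm u = 1" "E *v (E *v u) = s *\<^sub>R u"
    and s: "\<And>x. x \<bullet> (E *v (E *v x)) \<le> s * (norm x)\<^sup>2"
    using self_adjoint_has_maximal_eigenvector[OF lin selfE subspace_UNIV] by (metis UNIV_I UNIV_not_singleton)
  have quad: "x \<bullet> (E *v (E *v x)) = (norm (E *v x))\<^sup>2" for x
    by (simp add: inner_symmetric_matrix[OF symE] power2_norm_eq_inner)
  have s_eq: "s = (norm (E *v u))\<^sup>2"
    using quad[of u] u by (simp add: dot_square_norm)
  have "spectral_norm E = sqrt s"
  proof (rule antisym)
    show "spectral_norm E \<le> sqrt s"
    proof (rule spectral_norm_least)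
      fix x
      have "sqrt ((norm (E *v x))\<^sup>2) \<le> sqrt (s * (norm x)\<^sup>2)"
        using s[of x] quad[of x] by (intro real_sqrt_le_mono) simp
      then show "norm (E *v x) \<le> sqrt s * norm x" by (simp add: real_sqrt_mult)
    qed
    show "sqrt s \<le> spectral_norm E"
      using norm_le_spectral_norm[of E u] u(1) by (simp add: s_eq)
  qed
  then have s_norm: "s = (spectral_norm E)\<^sup>2" using s_eq by simp
  define W where "W = {x. E *v (E *v x) = s *\<^sub>R x}"
  have subW: "subspace W"
    unfolding W_def by (auto simp: subspace_def algebra_simps matrix_vector_mult_scaleR)
  have invW: "A *v x \<in> W" if "x \<in> W" for x
  proof -
    have "E *v (E *v (A *v x)) = A *v (E *v (E *v x))"
      by (metis comm matrix_vector_mul_assoc)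
    then show ?thesis using that by (simp add: W_def matrix_vector_mult_scaleR)
  qed
  have "u \<in> W" "u \<noteq> 0" using u by (auto simp: W_def)
  then have "W \<noteq> {0}" by blast
  \<comment> \<open>Second use, now for \<open>A\<close> on \<open>W\<close>. Working with
    \<open>E ** E\<close> rather than \<open>E\<close> avoids deciding whether the norm is attained
    at a positive or a negative eigenvalue of \<open>E\<close>.\<close>
  from self_adjoint_has_maximal_eigenvector[OF matrix_vector_mul_linear
      inner_symmetric_matrix[OF symA] subW invW this]
  obtain v \<mu> where "v \<in> W" "norm v = 1" "A *v v = \<mu> *\<^sub>R v"
    by blast
  then show ?thesis using that[of v \<mu>] s_norm by (cases "v = 0") (auto simp: W_def)
qed

section \<open>The norm of the initial residual\<close>

lemma transpose_residual:
  assumes "transpose A = A"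
  shows "transpose (mat 1 - matpoly d c A ** A) = mat 1 - matpoly d c A ** A"
  by (simp add: transpose_diff matrix_transpose_mul transpose_matpoly assms matpoly_commute)

text \<open>An eigenvector of \<open>A\<close> for \<open>\<mu>\<close> is an eigenvector of the
  residual for \<open>1 - \<mu> p(\<mu>)\<close>, so each modulus in the maximum is at most the
  norm. The common eigenvector of \<open>A\<close> and \<open>E ** E\<close> shows that one of them
  equals it.\<close>

lemma spectral_norm_residual:
  fixes A :: "real ^ 'n ^ 'n"
  assumes sym: "transpose A = A"
  shows "spectral_norm (mat 1 - matpoly d c A ** A) = max_residual d c A"
proof -
  define E where "E = mat 1 - matpoly d c A ** A"
  define q where "q = (\<lambda>\<mu>. 1 - \<mu> * (\<Sum>l\<le>d. c l * \<mu> ^ l))"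
  let ?S = "{\<mu>. \<exists>v. v \<noteq> 0 \<and> A *v v = \<mu> *\<^sub>R v}"
  have Eq: "E *v v = q \<mu> *\<^sub>R v" if "A *v v = \<mu> *\<^sub>R v" for v \<mu>
    by (simp add: E_def q_def matrix_vector_mult_diff_rdistrib matrix_vector_mul_assoc[symmetric]
        that matrix_vector_mult_scaleR matpoly_eigenvector[OF that] scaleR_diff_left)
  have symE: "transpose E = E" unfolding E_def by (rule transpose_residual[OF sym])
  have comm: "A ** E = E ** A"
    by (simp add: E_def matrix_diff_ldistrib matrix_diff_rdistrib matrix_mul_assoc matpoly_commute)
  obtain v \<mu> where v: "v \<noteq> 0" "A *v v = \<mu> *\<^sub>R v" "E *v (E *v v) = (spectral_norm E)\<^sup>2 *\<^sub>R v"
    by (rule eigenvector_attaining_spectral_norm[OF sym symE comm])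
  \<comment> \<open>Both sides are the eigenvalue of \<open>E ** E\<close> at the nonzero vector
    \<open>v\<close>.\<close>
  have "(q \<mu>)\<^sup>2 = (spectral_norm E)\<^sup>2"
    using v by (simp add: Eq[OF v(2)] matrix_vector_mult_scaleR power2_eq_square)
  then have attained: "spectral_norm E = \<bar>q \<mu>\<bar>"
    by (metis abs_of_nonneg power2_eq_iff_nonneg power2_abs abs_ge_zero spectral_norm_nonneg)
  have "cmod (1 - complex_of_real x * (\<Sum>l\<le>d. complex_of_real (c l) * complex_of_real x ^ l)) = \<bar>q x\<bar>" for x
  proof -
    have "1 - complex_of_real x * (\<Sum>l\<le>d. complex_of_real (c l) * complex_of_real x ^ l)
        = complex_of_real (q x)"
      by (simp add: q_def)
    then show ?thesis by (simp only: norm_of_real)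
  qed
  then have "max_residual d c A = Max ((\<lambda>x. \<bar>q x\<bar>) ` ?S)"
    by (simp add: max_residual_def spectrum_symmetric[OF sym] image_image)
  also have "\<dots> = spectral_norm E"
  proof (rule Max_eqI)
    show "finite ((\<lambda>x. \<bar>q x\<bar>) ` ?S)" using finite_eigenvalues_symmetric[OF sym] by simp
    show "spectral_norm E \<in> (\<lambda>x. \<bar>q x\<bar>) ` ?S" using v attained by blast
    fix y assume "y \<in> (\<lambda>x. \<bar>q x\<bar>) ` ?S"
    then show "y \<le> spectral_norm E" using Eq eigenvalue_le_spectral_norm by blast
  qed
  finally show ?thesis by (simp add: E_def)
qed

section \<open>The Moore-Penrose inverse under transposition and at full column rank\<close>

lemma moore_penrose_eq:
  assumes "is_moore_penrose A X"
  shows "moore_penrose A = X"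
  unfolding moore_penrose_def
  using assms is_moore_penrose_unique by blast

lemma is_moore_penrose_transpose:
  assumes "is_moore_penrose A X"
  shows "is_moore_penrose (transpose A) (transpose X)"
  using assms unfolding is_moore_penrose_def
  by (metis matrix_transpose_mul matrix_mul_assoc)

text \<open>Injectivity of \<open>M\<close> makes the Gram matrix invertible, since
  \<open>x \<bullet> (?G *v x)\<close> is the squared norm of \<open>M *v x\<close>. The witness is
  the classical left inverse, the inverse Gram matrix times \<open>transpose M\<close>.\<close>

lemma full_column_rank_moore_penrose:
  fixes M :: "real ^ 'q ^ 'p"
  assumes "rank M = CARD('q)"
  obtains Y where "is_moore_penrose M Y" "Y ** M = mat 1"
proof -
  let ?G = "transpose M ** M"
  have inj: "inj ((*v) M)" using assms by (simp add: full_rank_injective)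
  have "x = 0" if "?G *v x = 0" for x
  proof -
    have "(M *v x) \<bullet> (M *v x) = x \<bullet> (?G *v x)"
      by (metis dot_lmul_matrix inner_commute matrix_vector_mul_assoc transpose_matrix_vector)
    then have "M *v x = 0" using that by simp
    then show ?thesis using inj by (metis injD matrix_vector_mult_0_right)
  qed
  then obtain H where H: "H ** ?G = mat 1"
    using matrix_left_invertible_ker[of ?G] by blast
  then have H': "?G ** H = mat 1" by (simp add: matrix_left_right_inverse)
  have "transpose H = transpose H ** (?G ** H)" by (simp add: H')
  also have "\<dots> = transpose (?G ** H) ** H"
    by (simp add: matrix_transpose_mul matrix_mul_assoc)
  finally have symH: "transpose H = H" by (simp add: H')
  let ?Y = "H ** transpose M"
  have YM: "?Y ** M = mat 1" using H by (simp add: matrix_mul_assoc)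
  have "is_moore_penrose M ?Y"
    unfolding is_moore_penrose_def
  proof (intro conjI)
    show "M ** ?Y ** M = M" using YM by (simp flip: matrix_mul_assoc)
    show "transpose (M ** ?Y) = M ** ?Y" by (simp add: matrix_transpose_mul symH matrix_mul_assoc)
  qed (simp_all add: YM)
  with YM that show ?thesis by blast
qed

section \<open>Residuals and convergence of the Newton-Schulz iteration\<close>

text \<open>Each step rests on the identity \<open>I - (2X - XMX)M = (I - XM)^2\<close>.\<close>

lemma newton_schulz_residual:
  "mat 1 - newton_schulz M X0 k ** M = matpow (mat 1 - X0 ** M) (2 ^ k)"
proof (induction k)
  case (Suc k)
  let ?X = "newton_schulz M X0 k"
  have "mat 1 - newton_schulz M X0 (Suc k) ** M = (mat 1 - ?X ** M) ** (mat 1 - ?X ** M)"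
    by (simp add: matrix_diff_ldistrib matrix_diff_rdistrib matrix_mul_assoc
        scalar_matrix_assoc[symmetric]) (simp add: vec_eq_iff)
  also have "\<dots> = matpow (mat 1 - X0 ** M) (2 ^ Suc k)"
    by (simp add: Suc mult_2 matpow_add)
  finally show ?case .
qed simp

text \<open>Both terms of a step end in the previous iterate on the right, so being fixed by
  \<open>M ** Y\<close> on the right is inherited. This turns the residual into an error
  bound.\<close>

lemma newton_schulz_row_space:
  assumes "X0 ** (M ** Y) = X0"
  shows "newton_schulz M X0 k ** (M ** Y) = newton_schulz M X0 k"
  by (induction k)
    (simp_all add: assms matrix_diff_rdistrib flip: matrix_mul_assoc scalar_matrix_assoc)

text \<open>The product \<open>XMX\<close> is palindromic, so transposition maps the iteration for
  \<open>M\<close> to the one for \<open>transpose M\<close>; this is the bridge between the two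
  rank cases.\<close>

lemma transpose_newton_schulz:
  "transpose (newton_schulz M X0 k) = newton_schulz (transpose M) (transpose X0) k"
  by (induction k)
    (simp_all add: transpose_diff transpose_scalar matrix_transpose_mul matrix_mul_assoc)

lemma tendsto_matrix_if_spectral_norm:
  assumes "(\<lambda>k. spectral_norm (L - X k)) \<longlonglongrightarrow> 0"
  shows "X \<longlonglongrightarrow> L"
proof (intro vec_tendstoI)
  fix i j
  have "\<bar>X k $ i $ j - L $ i $ j\<bar> \<le> spectral_norm (L - X k)" for k
    using matrix_component_le_onorm[of "L - X k" i j]
    by (simp add: spectral_norm_def abs_minus_commute)
  then have "(\<lambda>k. X k $ i $ j - L $ i $ j) \<longlonglongrightarrow> 0"
    by (intro Lim_null_comparison[OF _ assms]) simp
  then show "(\<lambda>k. X k $ i $ j) \<longlonglongrightarrow> L $ i $ j" by (simp add: LIM_zero_iff)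
qed

lemma spectral_norm_mult_le: "spectral_norm (A ** B) \<le> spectral_norm A * spectral_norm B"
proof (rule spectral_norm_least)
  fix x
  have "norm (A *v (B *v x)) \<le> spectral_norm A * (spectral_norm B * norm x)"
    by (meson norm_le_spectral_norm mult_left_mono order_trans spectral_norm_nonneg)
  then show "norm ((A ** B) *v x) \<le> spectral_norm A * spectral_norm B * norm x"
    by (simp add: matrix_vector_mul_assoc mult.assoc)
qed

lemma newton_schulz_tendsto:
  fixes M :: "real ^ 'q ^ 'p"
  assumes YM: "Y ** M = mat 1" and row: "X0 ** (M ** Y) = X0"
    and res: "\<And>k. spectral_norm (mat 1 - newton_schulz M X0 k ** M) = \<eta> ^ (2 ^ k)"
    and \<eta>: "\<eta> < 1"
  shows "newton_schulz M X0 \<longlonglongrightarrow> Y"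
proof (rule tendsto_matrix_if_spectral_norm)
  let ?X = "newton_schulz M X0"
  \<comment> \<open>At \<open>k = 0\<close> the exponent is 1, so \<open>\<eta>\<close> is itself a
    norm.\<close>
  have \<eta>0: "0 \<le> \<eta>" using res[of 0] spectral_norm_nonneg by (metis power_0 power_one_right)
  have diff: "Y - ?X k = (mat 1 - ?X k ** M) ** Y" for k
    by (simp add: matrix_diff_rdistrib newton_schulz_row_space[OF row] flip: matrix_mul_assoc)
  \<comment> \<open>The bound is a subsequence of the geometric sequence of powers of
    \<open>\<eta>\<close>.\<close>
  have "strict_mono (\<lambda>k. 2 ^ k :: nat)" by (rule strict_monoI) simp
  then have "(\<lambda>k. \<eta> ^ (2 ^ k)) \<longlonglongrightarrow> 0"
    using LIMSEQ_subseq_LIMSEQ[OF LIMSEQ_realpow_zero[OF \<eta>0 \<eta>]] by (simp add: o_def)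
  then have lim: "(\<lambda>k. \<eta> ^ (2 ^ k) * spectral_norm Y) \<longlonglongrightarrow> 0"
    by (rule tendsto_mult_left_zero)
  have bound: "norm (spectral_norm (Y - ?X k)) \<le> \<eta> ^ (2 ^ k) * spectral_norm Y" for k
    using spectral_norm_mult_le[of "mat 1 - ?X k ** M" Y]
    by (simp add: diff[of k] res spectral_norm_nonneg)
  show "(\<lambda>k. spectral_norm (Y - ?X k)) \<longlonglongrightarrow> 0"
    by (rule Lim_null_comparison[OF _ lim]) (rule always_eventually, rule allI, rule bound)
qed

section \<open>The two rank cases\<close>

text \<open>Symmetry of the initial residual is exported as a conclusion because the full-row-rank
  case uses it to remove a transpose from the residuals.\<close>

lemma newton_schulz_full_column_rank:
  fixes M :: "real ^ 'q ^ 'p" and \<rho> :: real and d :: nat and c :: "nat \<Rightarrow> real"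
  assumes "rank M = CARD('q)"
  defines "B \<equiv> (1 / \<rho>) *\<^sub>R (transpose M ** M)"
  defines "X0 \<equiv> (1 / \<rho>) *\<^sub>R (matpoly d c B ** transpose M)"
  defines "\<eta> \<equiv> max_residual d c B"
  shows "\<eta> < 1 \<Longrightarrow> newton_schulz M X0 \<longlonglongrightarrow> moore_penrose M"
    and "transpose (mat 1 - X0 ** M) = mat 1 - X0 ** M"
    and "spectral_norm (mat 1 - newton_schulz M X0 k ** M) = \<eta> ^ (2 ^ k)"
proof -
  have symB: "transpose B = B" by (simp add: B_def transpose_scalar matrix_transpose_mul)
  have X0M: "X0 ** M = matpoly d c B ** B"
    by (simp add: X0_def B_def matrix_scalar_ac scalar_matrix_assoc[symmetric] matrix_mul_assoc)
  show symE: "transpose (mat 1 - X0 ** M) = mat 1 - X0 ** M"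
    unfolding X0M by (rule transpose_residual[OF symB])
  show res: "spectral_norm (mat 1 - newton_schulz M X0 k ** M) = \<eta> ^ (2 ^ k)" for k
    by (simp add: newton_schulz_residual spectral_norm_symmetric_matpow[OF symE])
      (simp add: X0M spectral_norm_residual[OF symB] \<eta>_def)
  obtain Y where Y: "is_moore_penrose M Y" "Y ** M = mat 1"
    using full_column_rank_moore_penrose[OF assms(1)] .
  \<comment> \<open>Since \<open>M ** Y\<close> is symmetric, the left side is the transpose of
    \<open>M ** Y ** M\<close>, which is \<open>M\<close>. As \<open>X0\<close> ends in
    \<open>transpose M\<close>, it is fixed as well.\<close>
  have "transpose M ** (M ** Y) = transpose M"
    using Y(1) unfolding is_moore_penrose_def by (metis matrix_transpose_mul)
  then have "X0 ** (M ** Y) = X0"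
    by (simp add: X0_def scalar_matrix_assoc[symmetric] flip: matrix_mul_assoc)
  then show "newton_schulz M X0 \<longlonglongrightarrow> moore_penrose M" if "\<eta> < 1"
    using newton_schulz_tendsto[OF Y(2) _ res that] moore_penrose_eq[OF Y(1)] by simp
qed

lemma tendsto_transpose:
  assumes "X \<longlonglongrightarrow> L"
  shows "(\<lambda>k. transpose (X k)) \<longlonglongrightarrow> transpose L"
  unfolding transpose_def
  by (intro tendsto_vec_lambda tendsto_vec_nth assms)

theorem theorem4p9:
  fixes M :: "real ^ 'q ^ 'p" and \<rho> :: real and d :: nat and c :: "nat \<Rightarrow> real"
  assumes "M \<noteq> 0" and "\<rho> \<ge> (spectral_norm M)\<^sup>2"
  shows "(rank M = CARD('q) \<longrightarrow>
           (let B = (1 / \<rho>) *\<^sub>R (transpose M ** M);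
                X0 = (1 / \<rho>) *\<^sub>R (matpoly d c B ** transpose M);
                \<eta> = max_residual d c B;
                X = newton_schulz M X0
            in (\<eta> < 1 \<longrightarrow> X \<longlonglongrightarrow> moore_penrose M) \<and>
               (\<forall>k. mat 1 - X k ** M = matpow (mat 1 - X0 ** M) (2 ^ k) \<and>
                    spectral_norm (mat 1 - X k ** M) = \<eta> ^ (2 ^ k))))
       \<and> (rank M = CARD('p) \<longrightarrow>
           (let C = (1 / \<rho>) *\<^sub>R (M ** transpose M);
                X0 = transpose M ** ((1 / \<rho>) *\<^sub>R matpoly d c C);
                \<eta> = max_residual d c C;
                X = newton_schulz M X0
            in (\<eta> < 1 \<longrightarrow> X \<longlonglongrightarrow> moore_penrose M) \<and>
               (\<forall>k. mat 1 - M ** X k = matpow (mat 1 - M ** X0) (2 ^ k) \<and>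
                    spectral_norm (mat 1 - M ** X k) = \<eta> ^ (2 ^ k))))"
proof (intro conjI impI)
  assume "rank M = CARD('q)"
  from newton_schulz_full_column_rank[OF this]
  show "let B = (1 / \<rho>) *\<^sub>R (transpose M ** M);
                X0 = (1 / \<rho>) *\<^sub>R (matpoly d c B ** transpose M);
                \<eta> = max_residual d c B;
                X = newton_schulz M X0
            in (\<eta> < 1 \<longrightarrow> X \<longlonglongrightarrow> moore_penrose M) \<and>
               (\<forall>k. mat 1 - X k ** M = matpow (mat 1 - X0 ** M) (2 ^ k) \<and>
                    spectral_norm (mat 1 - X k ** M) = \<eta> ^ (2 ^ k))"
    unfolding Let_def using newton_schulz_residual by blast
next
  assume rank: "rank M = CARD('p)"
  define C where "C = (1 / \<rho>) *\<^sub>R (M ** transpose M)"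
  define X0 where "X0 = transpose M ** ((1 / \<rho>) *\<^sub>R matpoly d c C)"
  define \<eta> where "\<eta> = max_residual d c C"
  let ?N = "transpose M" and ?Z0 = "transpose X0"
  have rankN: "rank ?N = CARD('p)" using rank by (simp add: rank_transpose)
  have CN: "C = (1 / \<rho>) *\<^sub>R (transpose ?N ** ?N)" by (simp add: C_def)
  have "transpose C = C" by (simp add: C_def transpose_scalar matrix_transpose_mul)
  then have Z0: "?Z0 = (1 / \<rho>) *\<^sub>R (matpoly d c C ** transpose ?N)"
    by (simp add: X0_def matrix_transpose_mul transpose_scalar transpose_matpoly
        scalar_matrix_assoc[symmetric])
  \<comment> \<open>For \<open>?N\<close> the Gram matrix is \<open>C\<close> and the starting
    matrix is \<open>?Z0\<close>, so \<open>\<eta>\<close> is the same in both formulations.\<close>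
  note dual = newton_schulz_full_column_rank[OF rankN, where \<rho> = \<rho> and d = d and c = c, folded CN, folded Z0 \<eta>_def]
  have X: "newton_schulz M X0 k = transpose (newton_schulz ?N ?Z0 k)" for k
    by (simp add: transpose_newton_schulz)
  have E0: "mat 1 - M ** X0 = mat 1 - ?Z0 ** ?N"
    using dual(2) by (simp add: transpose_diff matrix_transpose_mul)
  \<comment> \<open>Transposition gives the dual residual up to a transpose, which disappears
    because that residual is a power of a symmetric matrix.\<close>
  have E: "mat 1 - M ** newton_schulz M X0 k = mat 1 - newton_schulz ?N ?Z0 k ** ?N" for k
  proof -
    have "mat 1 - M ** newton_schulz M X0 k = transpose (mat 1 - newton_schulz ?N ?Z0 k ** ?N)"
      by (simp add: X transpose_diff matrix_transpose_mul)
    also have "\<dots> = mat 1 - newton_schulz ?N ?Z0 k ** ?N"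
      by (simp only: newton_schulz_residual transpose_matpow dual(2))
    finally show ?thesis .
  qed
  obtain Y where "is_moore_penrose ?N Y"
    using full_column_rank_moore_penrose[OF rankN] .
  then have "moore_penrose M = transpose (moore_penrose ?N)"
    using is_moore_penrose_transpose moore_penrose_eq by (metis transpose_transpose)
  then have "newton_schulz M X0 \<longlonglongrightarrow> moore_penrose M" if "\<eta> < 1"
    using tendsto_transpose[OF dual(1)[OF that]] by (simp add: X[symmetric])
  then show "let C = (1 / \<rho>) *\<^sub>R (M ** transpose M);
                X0 = transpose M ** ((1 / \<rho>) *\<^sub>R matpoly d c C);
                \<eta> = max_residual d c C;
                X = newton_schulz M X0
            in (\<eta> < 1 \<longrightarrow> X \<longlonglongrightarrow> moore_penrose M) \<and>
               (\<forall>k. mat 1 - M ** X k = matpow (mat 1 - M ** X0) (2 ^ k) \<and>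
                    spectral_norm (mat 1 - M ** X k) = \<eta> ^ (2 ^ k))"
    unfolding Let_def C_def[symmetric] X0_def[symmetric] \<eta>_def[symmetric]
    using E E0 dual(3) newton_schulz_residual[of ?N ?Z0] by simp
qed

end
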